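(* Let $m\ge4$ be an integer and let $D\subset\{1,\dots,m-1\}$ be a subset with more than one element. Then for all $n\ge1$ $$L_n\le\dim_H[D^{\mathbb{N}}]_m\le U_n,$$ where $L_n$ and $U_n$ are the real numbers given by $$\sum_{(d_1,\dots,d_n)\in D^n}\big([(d_1,\dots,d_n)]_m'(1)\big)^{L_n}=1,\qquad \sum_{(d_1,\dots,d_n)\in D^n}\big([(d_1,\dots,d_n)]_m'(0)\big)^{U_n}=1.$$
   Context: For an integer $m\ge3$ and $d\in\{1,\dots,m-1\}$ let $T_d:[0,1]\to[0,1]$, $T_d(x)=\log_m(d+x)$; these maps are contractions of $[0,1]$. For a finite sequence $(d_1,\dots,d_n)\in\{1,\dots,m-1\}^n$ write $[(d_1,\dots,d_n)]_m(x)=T_{d_1}\circ\cdots\circ T_{d_n}(x)$ for $x\in[0,1]$, and let $[(d_1,\dots,d_n)]_m'(x)$ denote the derivative of this function at $x$ (one-sided at the endpoints, or equivalently computed from the formula). For an infinite sequence $(d_k)_{k\ge1}\in\{1,\dots,m-1\}^{\mathbb{N}}$ the continued logarithm to base $m$ is $[(d_k)]_m=\lim_{n\to\infty}T_{d_1}\circ\cdots\circ T_{d_n}(0)\in[0,1]$. For $D\subset\{1,\dots,m-1\}$, the set $[D^{\mathbb{N}}]_m=\{[(d_k)]_m : (d_k)\in D^{\mathbb{N}}\}$ consists of all real numbers in $[0,1]$ that have a continued logarithm representation to base $m$ with all digits in $D$. $\dim_H$ denotes Hausdorff dimension. *)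

theory Defs
  imports "HOL-Analysis.Analysis"
begin

section \<open>Hausdorff measure and dimension\<close>

text \<open>
  The contribution of a covering set \<open>U\<close> to the \<open>s\<close>-dimensional sum.  For \<open>s = 0\<close> the usual
  convention is made explicit: a nonempty set counts 1 (also when its diameter is 0) and the
  empty set counts 0.  (In HOL, \<open>0 powr 0 = 0\<close>.)
\<close>

definition diam_powr :: "real \<Rightarrow> 'a::metric_space set \<Rightarrow> real" where
  "diam_powr s U = (if s = 0 then (if U = {} then 0 else 1) else diameter U powr s)"

text \<open>
  Boundedness is required separately because \<open>diameter\<close> is real-valued and meaningless on
  unbounded sets.  Finite covers are included, as the \<open>U i\<close> may be empty.
\<close>

definition delta_covers :: "real \<Rightarrow> 'a::metric_space set \<Rightarrow> (nat \<Rightarrow> 'a set) set" where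
  "delta_covers \<delta> A = {U. A \<subseteq> (\<Union>i. U i) \<and> (\<forall>i. bounded (U i) \<and> diameter (U i) \<le> \<delta>)}"

definition hausdorff_premeasure :: "real \<Rightarrow> real \<Rightarrow> 'a::metric_space set \<Rightarrow> ennreal" where
  "hausdorff_premeasure s \<delta> A = (INF U\<in>delta_covers \<delta> A. \<Sum>i. ennreal (diam_powr s (U i)))"

definition hausdorff_measure :: "real \<Rightarrow> 'a::metric_space set \<Rightarrow> ennreal" where
  "hausdorff_measure s A = (SUP \<delta>\<in>{0<..}. hausdorff_premeasure s \<delta> A)"

definition hausdorff_dim :: "'a::metric_space set \<Rightarrow> ereal" where
  "hausdorff_dim A = Inf {ereal s | s. 0 \<le> s \<and> hausdorff_measure s A = 0}"


section \<open>Continued logarithms\<close>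

definition clog_map :: "nat \<Rightarrow> nat \<Rightarrow> real \<Rightarrow> real" where
  "clog_map m d x = log (real m) (real d + x)"

text \<open>\<open>clog_word m [d\<^sub>1, \<dots>, d\<^sub>n] = clog_map m d\<^sub>1 \<circ> \<dots> \<circ> clog_map m d\<^sub>n\<close>\<close>

definition clog_word :: "nat \<Rightarrow> nat list \<Rightarrow> real \<Rightarrow> real" where
  "clog_word m ds x = foldr (clog_map m) ds x"

text \<open>
  The derivative is taken relative to the domain \<open>[0,1]\<close>, hence one-sided at the endpoints.
\<close>

definition clog_word_deriv :: "nat \<Rightarrow> nat list \<Rightarrow> real \<Rightarrow> real" where
  "clog_word_deriv m ds x = vector_derivative (clog_word m ds) (at x within {0..1})"

text \<open>Infinite digit sequences are indexed from 0, so \<open>d 0\<close> is the first digit.\<close>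

definition clog :: "nat \<Rightarrow> (nat \<Rightarrow> nat) \<Rightarrow> real" where
  "clog m d = lim (\<lambda>n. clog_word m (map d [0..<n]) 0)"

definition clog_set :: "nat \<Rightarrow> nat set \<Rightarrow> real set" where
  "clog_set m D = {clog m d | d. \<forall>k. d k \<in> D}"

definition digit_words :: "nat set \<Rightarrow> nat \<Rightarrow> nat list set" where
  "digit_words D n = {ds. length ds = n \<and> set ds \<subseteq> D}"

end

theory Submission
  imports Defs
begin

text \<open>
  The words of length \<open>n\<close> form a finite system of increasing contractions of \<open>{0..1}\<close> whose images
  have disjoint interiors and whose attractor is \<open>clog_set m D\<close>. A word has a decreasing
  derivative, so its difference quotients lie between the derivatives at 1 and at 0. The upper
  bound comes from covering the attractor by its images under compositions of \<open>k\<close> words. For the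
  lower bound, give such a composition the \<open>L\<close>-th power of the product of its derivatives at 1 as
  weight. The weights sum to 1, and those meeting a set of diameter \<open>t\<close> sum to at most a constant
  times \<open>t powr L\<close> once \<open>k\<close> is large; by compactness this contradicts covers of small \<open>s\<close>-sum for
  \<open>s < L\<close>.
\<close>

section \<open>Dimension bounds for separated contractions of the unit interval\<close>

text \<open>As a function of \<open>s\<close> the sum is continuous and strictly decreasing, equals
  \<open>card I\<close> at 0 and tends to 0 at infinity. The intermediate value theorem gives a
  root, and strict monotonicity makes it unique.\<close>

lemma ex1_sum_powr_eq_1:
  fixes r :: "'i \<Rightarrow> real"
  assumes "finite I" "I \<noteq> {}" and r: "\<And>i. i \<in> I \<Longrightarrow> 0 < r i" "\<And>i. i \<in> I \<Longrightarrow> r i < 1"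
  shows "\<exists>!s. (\<Sum>i\<in>I. r i powr s) = 1"
proof -
  define g where "g s = (\<Sum>i\<in>I. r i powr s)" for s
  have less: "g t < g s" if "s < t" for s t
    unfolding g_def using that assms by (intro sum_strict_mono powr_less_mono') auto
  have "g \<midarrow>x\<rightarrow> g x" for x
    unfolding g_def using r by (intro tendsto_sum tendsto_powr tendsto_intros) force+
  then have cont: "isCont g x" for x
    by (simp add: isCont_def)
  have "(g \<longlongrightarrow> (\<Sum>i\<in>I. 0)) at_top"
    unfolding g_def
  proof (rule tendsto_sum)
    fix i assume "i \<in> I"
    then have "filterlim (\<lambda>s. ln (r i) * s) at_bot at_top"
      using r by (intro filterlim_tendsto_neg_mult_at_bot[OF tendsto_const] filterlim_ident) auto
    then have "((\<lambda>s. exp (ln (r i) * s)) \<longlongrightarrow> 0) at_top"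
      by (rule filterlim_compose[OF exp_at_bot])
    then show "((\<lambda>s. r i powr s) \<longlongrightarrow> 0) at_top"
      using r[OF \<open>i \<in> I\<close>] by (simp add: powr_def mult.commute)
  qed
  then have "eventually (\<lambda>s. g s < 1 \<and> 0 \<le> s) at_top"
    by (intro eventually_conj eventually_ge_at_top order_tendstoD(2)[where y = 0]) auto
  then obtain b where b: "g b < 1" "0 \<le> b"
    by (auto simp: eventually_at_top_linorder)
  \<comment> \<open>Positivity of \<open>r i\<close> matters here, because
    \<open>0 powr 0 = 0\<close>.\<close>
  have "g 0 = (\<Sum>i\<in>I. 1)"
    unfolding g_def by (intro sum.cong) (auto dest: r)
  with assms(1,2) have "1 \<le> g 0"
    by (simp add: Suc_leI card_gt_0_iff)
  then have "\<exists>s. 0 \<le> s \<and> s \<le> b \<and> g s = 1"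
    using b cont by (intro IVT2) auto
  moreover have "s = t" if "g s = 1" "g t = 1" for s t
    using less[of s t] less[of t s] that by linarith
  ultimately show ?thesis
    unfolding g_def[symmetric] by blast
qed

section \<open>Compositions in an abstract system of contractions\<close>

text \<open>In the application the letters are themselves digit words of length \<open>n\<close>, so
  an element is then a list of lists.\<close>

definition words :: "'i set \<Rightarrow> nat \<Rightarrow> 'i list set" where
  "words I k = {w. set w \<subseteq> I \<and> length w = k}"

lemma words_0 [simp]: "words I 0 = {[]}"
  by (auto simp: words_def)

lemma finite_words [simp]: "finite I \<Longrightarrow> finite (words I k)"
  unfolding words_def by (rule finite_lists_length_eq)

lemma sum_words_Suc:
  assumes "finite I"
  shows "(\<Sum>w\<in>words I (Suc k). h w) = (\<Sum>i\<in>I. \<Sum>w\<in>words I k. h (i # w))"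
proof -
  have "(\<Sum>w\<in>words I (Suc k). h w) = (\<Sum>(i, w)\<in>I \<times> words I k. h (i # w))"
    by (rule sum.reindex_bij_witness[of _ "\<lambda>(i, w). i # w" "\<lambda>w. (hd w, tl w)"])
      (auto simp: words_def length_Suc_conv)
  then show ?thesis
    using assms by (simp add: sum.cartesian_product)
qed

text \<open>Derivatives enter only through bounds on difference quotients. Images may share an
  endpoint, as those of consecutive digits do. The attractor \<open>X\<close> is a parameter, so its
  existence is settled in the application.\<close>

locale interval_ifs =
  fixes I :: "'i set" and f :: "'i \<Rightarrow> real \<Rightarrow> real" and \<rho> \<sigma> :: "'i \<Rightarrow> real" and X :: "real set"
  assumes finite_I: "finite I" and nonempty_I: "I \<noteq> {}"
    and maps: "\<And>i x. i \<in> I \<Longrightarrow> x \<in> {0..1} \<Longrightarrow> f i x \<in> {0..1}"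
    and lower: "\<And>i x y. i \<in> I \<Longrightarrow> 0 \<le> x \<Longrightarrow> x \<le> y \<Longrightarrow> y \<le> 1 \<Longrightarrow> \<rho> i * (y - x) \<le> f i y - f i x"
    and upper: "\<And>i x y. i \<in> I \<Longrightarrow> 0 \<le> x \<Longrightarrow> x \<le> y \<Longrightarrow> y \<le> 1 \<Longrightarrow> f i y - f i x \<le> \<sigma> i * (y - x)"
    and \<rho>_pos: "\<And>i. i \<in> I \<Longrightarrow> 0 < \<rho> i" and \<sigma>_less_1: "\<And>i. i \<in> I \<Longrightarrow> \<sigma> i < 1"
    and separated: "\<And>i j. i \<in> I \<Longrightarrow> j \<in> I \<Longrightarrow> i \<noteq> j \<Longrightarrow> f i 1 \<le> f j 0 \<or> f j 1 \<le> f i 0"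
    and compact_X: "compact X" and nonempty_X: "X \<noteq> {}" and X_subset: "X \<subseteq> {0..1}"
    and invariant: "X = (\<Union>i\<in>I. f i ` X)"
begin

lemma \<rho>_le_\<sigma>: "i \<in> I \<Longrightarrow> \<rho> i \<le> \<sigma> i"
  using lower[of i 0 1] upper[of i 0 1] by simp

lemma \<sigma>_pos: "i \<in> I \<Longrightarrow> 0 < \<sigma> i"
  using \<rho>_pos[of i] \<rho>_le_\<sigma>[of i] by simp

lemma \<rho>_less_1: "i \<in> I \<Longrightarrow> \<rho> i < 1"
  using \<sigma>_less_1[of i] \<rho>_le_\<sigma>[of i] by simp

lemma mono: "i \<in> I \<Longrightarrow> 0 \<le> x \<Longrightarrow> x \<le> y \<Longrightarrow> y \<le> 1 \<Longrightarrow> f i x \<le> f i y"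
  using lower[of i x y] \<rho>_pos[of i] by (smt (verit) mult_nonneg_nonneg)

lemma abs_lower:
  assumes "i \<in> I" "x \<in> {0..1}" "y \<in> {0..1}"
  shows "\<rho> i * \<bar>y - x\<bar> \<le> \<bar>f i y - f i x\<bar>"
proof (cases "x \<le> y")
  case True
  then show ?thesis using lower[of i x y] assms by auto
next
  case False
  then show ?thesis using lower[of i y x] assms by auto
qed

lemma abs_upper:
  assumes "i \<in> I" "x \<in> {0..1}" "y \<in> {0..1}"
  shows "\<bar>f i y - f i x\<bar> \<le> \<sigma> i * \<bar>y - x\<bar>"
proof (cases "x \<le> y")
  case True
  then show ?thesis using upper[of i x y] mono[of i x y] assms by auto
next
  case False
  then show ?thesis using upper[of i y x] mono[of i y x] assms by auto
qed

lemma foldr_maps: "set w \<subseteq> I \<Longrightarrow> x \<in> {0..1} \<Longrightarrow> foldr f w x \<in> {0..1}"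
  by (induction w) (auto simp del: atLeastAtMost_iff intro!: maps)

lemma foldr_in_X: "set w \<subseteq> I \<Longrightarrow> x \<in> X \<Longrightarrow> foldr f w x \<in> X"
  by (induction w) (use invariant in auto)

lemma X_eq_Union_words: "X = (\<Union>w\<in>words I k. foldr f w ` X)"
proof (induction k)
  case (Suc k)
  have "words I (Suc k) = (\<Union>i\<in>I. (#) i ` words I k)"
    by (auto simp: words_def length_Suc_conv)
  then have "(\<Union>w\<in>words I (Suc k). foldr f w ` X) = (\<Union>i\<in>I. f i ` (\<Union>w\<in>words I k. foldr f w ` X))"
    by (fastforce simp: image_iff)
  then show ?case
    using Suc invariant by simp
qed simp

lemma foldr_abs_upper:
  assumes "set w \<subseteq> I" "x \<in> {0..1}" "y \<in> {0..1}"
  shows "\<bar>foldr f w y - foldr f w x\<bar> \<le> prod_list (map \<sigma> w) * \<bar>y - x\<bar>"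
  using assms(1)
proof (induction w)
  case (Cons i w)
  have "\<bar>foldr f (i # w) y - foldr f (i # w) x\<bar> \<le> \<sigma> i * \<bar>foldr f w y - foldr f w x\<bar>"
    using Cons.prems assms by (simp del: atLeastAtMost_iff add: abs_upper foldr_maps)
  also have "\<dots> \<le> \<sigma> i * (prod_list (map \<sigma> w) * \<bar>y - x\<bar>)"
    using Cons \<sigma>_pos[of i] by (intro mult_left_mono) auto
  finally show ?case by (simp add: mult.assoc)
qed simp

lemma prod_list_pos: "set w \<subseteq> I \<Longrightarrow> (\<And>i. i \<in> I \<Longrightarrow> 0 < r i) \<Longrightarrow> 0 < prod_list (map r w)" for r :: "'i \<Rightarrow> real"
  by (induction w) auto

lemma prod_list_le_power:
  fixes r :: "'i \<Rightarrow> real"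
  assumes "set w \<subseteq> I" "\<And>i. i \<in> I \<Longrightarrow> 0 < r i"
  shows "prod_list (map r w) \<le> Max (r ` I) ^ length w"
  using assms(1)
proof (induction w)
  case (Cons i w)
  then have "r i \<le> Max (r ` I)" "0 < r i"
    using assms(2) finite_I by auto
  moreover have "prod_list (map r w) \<le> Max (r ` I) ^ length w" "0 < prod_list (map r w)"
    using Cons prod_list_pos[of w r] assms(2) by auto
  ultimately have "r i * prod_list (map r w) \<le> Max (r ` I) * Max (r ` I) ^ length w"
    by (intro mult_mono) auto
  then show ?case by simp
qed simp

text \<open>Expanding the \<open>k\<close>-th power of the sum gives one product for each word. At
  an exponent solving the defining equation, the weights therefore sum to 1 at every level.\<close>

lemma sum_words_powr:
  fixes r :: "'i \<Rightarrow> real"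
  assumes "\<And>i. i \<in> I \<Longrightarrow> 0 < r i"
  shows "(\<Sum>w\<in>words I k. prod_list (map r w) powr s) = (\<Sum>i\<in>I. r i powr s) ^ k"
proof (induction k)
  case (Suc k)
  have "(\<Sum>w\<in>words I (Suc k). prod_list (map r w) powr s)
      = (\<Sum>i\<in>I. \<Sum>w\<in>words I k. r i powr s * prod_list (map r w) powr s)"
    unfolding sum_words_Suc[OF finite_I] using assms
    by (intro sum.cong) (auto simp: words_def powr_mult less_imp_le prod_list_pos)
  then show ?case
    using Suc by (simp add: sum_distrib_left[symmetric] sum_distrib_right[symmetric])
qed simp

lemma Max_bounds:
  assumes "\<And>i. i \<in> I \<Longrightarrow> 0 < r i" "\<And>i. i \<in> I \<Longrightarrow> r i < 1"
  shows "0 < Max (r ` I)" "Max (r ` I) < (1::real)"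
  using assms finite_I nonempty_I by (auto simp: Max_gr_iff)

section \<open>Upper bound by covers\<close>

text \<open>Beyond \<open>U\<close> the sum \<open>q\<close> of the \<open>s\<close>-th powers is
  less than 1. The images under words of length \<open>k\<close> have diameters at most
  \<open>c ^ k\<close> and \<open>s\<close>-sum at most \<open>q ^ k\<close>, and both tend to
  0.\<close>

lemma hausdorff_measure_eq_0:
  assumes U: "(\<Sum>i\<in>I. \<sigma> i powr U) = 1" and s: "U < s" "0 < s"
  shows "hausdorff_measure s X = 0"
proof -
  define q where "q = (\<Sum>i\<in>I. \<sigma> i powr s)"
  define c where "c = Max (\<sigma> ` I)"
  have c: "0 < c" "c < 1"
    using Max_bounds[of \<sigma>] \<sigma>_pos \<sigma>_less_1 by (auto simp: c_def)
  have "q < (\<Sum>i\<in>I. \<sigma> i powr U)"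
    unfolding q_def using s \<sigma>_pos \<sigma>_less_1 finite_I nonempty_I
    by (intro sum_strict_mono powr_less_mono') auto
  then have q: "0 \<le> q" "q < 1"
    using U by (auto simp: q_def intro!: sum_nonneg)
  have le: "hausdorff_premeasure s \<delta> X \<le> ennreal (q ^ k)" if "c ^ k \<le> \<delta>" for k \<delta>
  proof -
    define W where "W = words I k"
    have W: "finite W"
      using finite_I by (simp add: W_def)
    then obtain g where g: "bij_betw g {..<card W} W"
      using ex_bij_betw_nat_finite[of W] by (auto simp: lessThan_atLeast0)
    \<comment> \<open>A cover is a sequence of sets: the finitely many words are enumerated by
      \<open>g\<close>, and the tail consists of empty sets, which contribute 0 since
      \<open>0 < s\<close>.\<close>
    define V where "V i = (if i < card W then foldr f (g i) ` X else {})" for i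
    have diam: "bounded (foldr f w ` X) \<and> diameter (foldr f w ` X) \<le> prod_list (map \<sigma> w)" if "w \<in> W" for w
    proof
      have w: "set w \<subseteq> I"
        using that by (auto simp: W_def words_def)
      have "foldr f w ` X \<subseteq> X"
        using w by (auto intro: foldr_in_X)
      then show "bounded (foldr f w ` X)"
        using compact_X bounded_subset compact_imp_bounded by blast
      show "diameter (foldr f w ` X) \<le> prod_list (map \<sigma> w)"
      proof (rule diameter_le)
        fix x y assume "x \<in> foldr f w ` X" "y \<in> foldr f w ` X"
        then obtain x' y' where xy: "x' \<in> X" "y' \<in> X" "x = foldr f w x'" "y = foldr f w y'"
          by auto
        then have "x' \<in> {0..1}" "y' \<in> {0..1}"
          using X_subset by auto
        moreover from this have "\<bar>x' - y'\<bar> \<le> 1"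
          by auto
        ultimately show "norm (x - y) \<le> prod_list (map \<sigma> w)"
          using foldr_abs_upper[OF w, of y' x'] xy prod_list_pos[OF w, of \<sigma>] \<sigma>_pos
          by (smt (verit) mult_left_le real_norm_def)
      qed (use nonempty_X in auto)
    qed
    have "V \<in> delta_covers \<delta> X"
    proof -
      have "X \<subseteq> (\<Union>i. V i)"
      proof
        fix x assume "x \<in> X"
        then obtain w where w: "w \<in> W" "x \<in> foldr f w ` X"
          using X_eq_Union_words[of k] unfolding W_def by blast
        moreover from this obtain i where "i < card W" "g i = w"
          using g by (metis bij_betw_imp_surj_on imageE lessThan_iff)
        ultimately show "x \<in> (\<Union>i. V i)"
          by (auto simp: V_def)
      qed
      moreover have "bounded (V i) \<and> diameter (V i) \<le> \<delta>" for i
      proof (cases "i < card W")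
        case True
        then have "g i \<in> W"
          using g by (auto simp: bij_betw_def)
        moreover from this have "prod_list (map \<sigma> (g i)) \<le> c ^ k"
          using prod_list_le_power[of "g i" \<sigma>] \<sigma>_pos by (auto simp: W_def words_def c_def)
        ultimately show ?thesis
          using True diam[of "g i"] that by (auto simp: V_def)
      next
        case False
        then show ?thesis
          using that c by (simp add: V_def) (meson order_trans zero_le_power less_imp_le)
      qed
      ultimately show ?thesis
        by (auto simp: delta_covers_def)
    qed
    then have "hausdorff_premeasure s \<delta> X \<le> (\<Sum>i. ennreal (diam_powr s (V i)))"
      unfolding hausdorff_premeasure_def by (rule INF_lower)
    also have "\<dots> = (\<Sum>i<card W. ennreal (diam_powr s (V i)))"
      using s by (intro suminf_finite) (auto simp: V_def diam_powr_def)
    also have "\<dots> = (\<Sum>i<card W. ennreal (diam_powr s (foldr f (g i) ` X)))"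
      by (simp add: V_def)
    also have "\<dots> = (\<Sum>w\<in>W. ennreal (diam_powr s (foldr f w ` X)))"
      by (rule sum.reindex_bij_betw[OF g])
    also have "\<dots> \<le> (\<Sum>w\<in>W. ennreal (prod_list (map \<sigma> w) powr s))"
      using diam s by (intro sum_mono ennreal_leI) (auto simp: diam_powr_def intro!: powr_mono2 diameter_ge_0)
    also have "\<dots> = ennreal (q ^ k)"
      using sum_words_powr[of \<sigma> s k] \<sigma>_pos by (simp add: sum_ennreal W_def q_def)
    finally show ?thesis .
  qed
  have "hausdorff_premeasure s \<delta> X = 0" if "0 < \<delta>" for \<delta>
  proof -
    have "(\<lambda>k. c ^ k) \<longlonglongrightarrow> 0"
      using c by (intro LIMSEQ_power_zero) auto
    then have "eventually (\<lambda>k. c ^ k < \<delta>) sequentially"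
      using that by (rule order_tendstoD(2))
    then have "eventually (\<lambda>k. hausdorff_premeasure s \<delta> X \<le> ennreal (q ^ k)) sequentially"
      by (rule eventually_mono) (simp add: le)
    moreover have "(\<lambda>k. ennreal (q ^ k)) \<longlonglongrightarrow> ennreal 0"
      using q by (intro tendsto_ennrealI LIMSEQ_power_zero) auto
    ultimately have "hausdorff_premeasure s \<delta> X \<le> ennreal 0"
      using tendsto_lowerbound by fastforce
    then show ?thesis by simp
  qed
  then show ?thesis
    unfolding hausdorff_measure_def by (auto intro!: antisym SUP_least)
qed

theorem hausdorff_dim_le:
  assumes U: "(\<Sum>i\<in>I. \<sigma> i powr U) = 1"
  shows "hausdorff_dim X \<le> ereal U"
proof -
  \<comment> \<open>The infimum defining the dimension ranges over nonnegative exponents only. A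
    negative \<open>U\<close> would make the sum exceed its value \<open>card I \<ge> 1\<close> at
    exponent 0.\<close>
  have "0 \<le> U"
  proof (rule ccontr)
    assume "\<not> 0 \<le> U"
    then have "(\<Sum>i\<in>I. \<sigma> i powr 0) < (\<Sum>i\<in>I. \<sigma> i powr U)"
      using \<sigma>_pos \<sigma>_less_1 finite_I nonempty_I by (intro sum_strict_mono powr_less_mono') auto
    moreover have "(\<Sum>i\<in>I. \<sigma> i powr 0) = (\<Sum>i\<in>I. 1)"
      by (intro sum.cong) (auto dest: \<sigma>_pos)
    moreover have "card I > 0"
      using finite_I nonempty_I by (simp add: card_gt_0_iff)
    ultimately show False
      using U by simp
  qed
  show ?thesis
  proof (rule ereal_le_epsilon2)
    fix e :: real assume "0 < e"
    then have "hausdorff_measure (U + e) X = 0"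
      using \<open>0 \<le> U\<close> by (intro hausdorff_measure_eq_0[OF U]) auto
    then have "hausdorff_dim X \<le> ereal (U + e)"
      unfolding hausdorff_dim_def using \<open>0 < e\<close> \<open>0 \<le> U\<close> by (intro Inf_lower) auto
    then show "hausdorff_dim X \<le> ereal U + ereal e" by simp
  qed
qed

section \<open>Lower bound by mass distribution\<close>

text \<open>Level \<open>k\<close> of the self-similar mass distribution: a word \<open>w\<close>
  puts its weight at the point \<open>foldr f w p\<close>. Working with finite levels avoids
  constructing a limit measure.\<close>

definition mass :: "real \<Rightarrow> real \<Rightarrow> nat \<Rightarrow> real set \<Rightarrow> real" where
  "mass s p k J = (\<Sum>w\<in>words I k. if foldr f w p \<in> J then prod_list (map \<rho> w) powr s else 0)"

text \<open>Splits off the outermost letter. All points \<open>foldr f w p\<close> lie in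
  \<open>{0..1}\<close>, so restricting the pullback to this interval loses no mass, and
  \<open>abs_lower\<close> applies there.\<close>

lemma mass_Suc: "mass s p (Suc k) J = (\<Sum>i\<in>I. \<rho> i powr s * mass s p k {y\<in>{0..1}. f i y \<in> J})"
  if "p \<in> {0..1}"
  unfolding mass_def sum_words_Suc[OF finite_I] sum_distrib_left
  using that \<rho>_pos foldr_maps
  by (intro sum.cong) (auto simp: words_def powr_mult less_imp_le prod_list_pos simp del: atLeastAtMost_iff)

lemma mass_empty: "mass s p k {} = 0"
  by (simp add: mass_def)

context
  fixes s p :: real
  assumes s: "(\<Sum>i\<in>I. \<rho> i powr s) = 1" and s_nonneg: "0 \<le> s" and p: "p \<in> {0..1}"
begin

lemma mass_le_1: "mass s p k J \<le> 1"
proof -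
  have "mass s p k J \<le> (\<Sum>w\<in>words I k. prod_list (map \<rho> w) powr s)"
    unfolding mass_def by (intro sum_mono) auto
  also have "\<dots> = 1"
    using sum_words_powr[of \<rho> s k] \<rho>_pos s by simp
  finally show ?thesis .
qed

text \<open>The induction step of both mass estimates: a pullback by \<open>f i\<close> enlarges
  lengths by a factor of at most \<open>1 / \<rho> i\<close>, which the weight
  \<open>\<rho> i powr s\<close> compensates, so the constant \<open>A\<close> does not grow. The
  power of the largest \<open>\<rho> i\<close> is the resolution of level \<open>k\<close>; at level
  0 it is 1, which makes the base cases trivial.\<close>

lemma mass_scaled:
  assumes i: "i \<in> I" and A: "0 \<le> A" and t: "0 \<le> t"
    and le: "mass s p k J \<le> A * max (t / \<rho> i) (Max (\<rho> ` I) ^ k) powr s"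
  shows "\<rho> i powr s * mass s p k J \<le> A * max t (Max (\<rho> ` I) ^ Suc k) powr s"
proof -
  let ?c = "Max (\<rho> ` I)"
  have c: "\<rho> i \<le> ?c" "0 < \<rho> i"
    using i finite_I \<rho>_pos by auto
  have "\<rho> i powr s * mass s p k J \<le> \<rho> i powr s * (A * max (t / \<rho> i) (?c ^ k) powr s)"
    using le by (intro mult_left_mono) auto
  also have "\<dots> = A * (\<rho> i * max (t / \<rho> i) (?c ^ k)) powr s"
    using c t by (simp add: powr_mult)
  also have "\<rho> i * max (t / \<rho> i) (?c ^ k) = max t (\<rho> i * ?c ^ k)"
    using c by (simp add: max_mult_distrib_left)
  also have "A * \<dots> powr s \<le> A * max t (?c ^ Suc k) powr s"
    using c t s_nonneg A by (intro mult_left_mono powr_mono2 max.mono mult_right_mono) (auto simp: mult_right_mono)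
  finally show ?thesis .
qed

text \<open>For \<open>t\<close> below every \<open>\<rho> i\<close>, the set meets at most one
  image, and its pullback again lies near the same endpoint \<open>e\<close>, so the induction has a
  single branch. For larger \<open>t\<close> the right-hand side is at least 1.\<close>

lemma mass_near_endpoint:
  assumes "e \<in> {0, 1}" "0 < t" "\<And>x. x \<in> J \<Longrightarrow> x \<in> {0..1} \<and> \<bar>x - e\<bar> \<le> t"
  shows "mass s p k J \<le> (1 / Min (\<rho> ` I)) powr s * max t (Max (\<rho> ` I) ^ k) powr s"
  using assms(2,3)
proof (induction k arbitrary: J t)
  case 0
  have "0 < Min (\<rho> ` I)" "Min (\<rho> ` I) < 1"
    using \<rho>_pos \<rho>_less_1 finite_I nonempty_I by (auto simp: Min_gr_iff Min_less_iff)
  then have "1 * 1 \<le> (1 / Min (\<rho> ` I)) powr s * max t 1 powr s"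
    using s_nonneg by (intro mult_mono ge_one_powr_ge_zero) auto
  then show ?case
    using mass_le_1[of 0 J] by simp
next
  case (Suc k)
  let ?b = "Min (\<rho> ` I)" and ?c = "Max (\<rho> ` I)"
  have b: "0 < ?b" "?b \<le> \<rho> i" if "i \<in> I" for i
    using \<rho>_pos finite_I nonempty_I that by (auto simp: Min_gr_iff)
  have b_pos: "0 < ?b"
    using \<rho>_pos finite_I nonempty_I by (auto simp: Min_gr_iff)
  define P where "P i = {y\<in>{0..1}. f i y \<in> J}" for i
  show ?case
  proof (cases "t < ?b")
    case False
    then have "1 \<le> (1 / ?b * t) powr s"
      using b_pos s_nonneg by (intro ge_one_powr_ge_zero) auto
    also have "\<dots> = (1 / ?b) powr s * t powr s"
      by (rule powr_mult)
    also have "\<dots> \<le> (1 / ?b) powr s * max t (?c ^ Suc k) powr s"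
      using Suc.prems s_nonneg by (intro mult_left_mono powr_mono2) auto
    finally show ?thesis
      using mass_le_1[of "Suc k" J] by linarith
  next
    case True
    \<comment> \<open>Of two separated images one lies between \<open>e\<close> and the other. Its
      length is at least \<open>?b > t\<close>, so the farther image has no point within
      \<open>t\<close> of \<open>e\<close>.\<close>
    have unique: "j = i" if ij: "i \<in> I" "j \<in> I" "y \<in> P i" "z \<in> P j" for i j y z
    proof (rule ccontr)
      assume "j \<noteq> i"
      then have "f i 1 \<le> f j 0 \<or> f j 1 \<le> f i 0"
        using separated ij by auto
      moreover have "y \<in> {0..1}" "z \<in> {0..1}" "\<bar>f i y - e\<bar> \<le> t" "\<bar>f j z - e\<bar> \<le> t"
        using ij Suc.prems(2) by (auto simp: P_def)
      moreover have "\<rho> i \<le> f i 1 - f i 0" "\<rho> j \<le> f j 1 - f j 0"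
        using lower[of i 0 1] lower[of j 0 1] ij by auto
      moreover have "f i 0 \<le> f i y" "f i y \<le> f i 1" "f j 0 \<le> f j z" "f j z \<le> f j 1"
        using mono ij by (auto simp: P_def)
      moreover have "0 \<le> f i 0" "f i 1 \<le> 1" "0 \<le> f j 0" "f j 1 \<le> 1"
        using maps[of i 0] maps[of i 1] maps[of j 0] maps[of j 1] ij by auto
      ultimately show False
        using True b[of i] b[of j] ij assms(1) by auto
    qed
    show ?thesis
    proof (cases "\<exists>i\<in>I. P i \<noteq> {}")
      case False
      then have "mass s p (Suc k) J = 0"
        unfolding mass_Suc[OF p] P_def[symmetric] by (intro sum.neutral) (auto simp: mass_empty)
      then show ?thesis by simp
    next
      case True
      then obtain i where i: "i \<in> I" "P i \<noteq> {}"
        by blast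
      have "mass s p (Suc k) J = (\<Sum>j\<in>I. if j = i then \<rho> i powr s * mass s p k (P i) else 0)"
        unfolding mass_Suc[OF p] P_def[symmetric]
      proof (intro sum.cong refl)
        fix j assume "j \<in> I"
        then have "P j = {}" if "j \<noteq> i"
          using unique[of i j] i that by blast
        then show "\<rho> j powr s * mass s p k (P j) = (if j = i then \<rho> i powr s * mass s p k (P i) else 0)"
          by (simp add: mass_empty)
      qed
      also have "\<dots> = \<rho> i powr s * mass s p k (P i)"
        using i finite_I by simp
      also have "\<dots> \<le> (1 / ?b) powr s * max t (?c ^ Suc k) powr s"
      proof (rule mass_scaled[OF i(1)])
        show "mass s p k (P i) \<le> (1 / ?b) powr s * max (t / \<rho> i) (?c ^ k) powr s"
        proof (rule Suc.IH)
          show "0 < t / \<rho> i"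
            using Suc.prems \<rho>_pos i by simp
          fix y assume y: "y \<in> P i"
          then have y01: "y \<in> {0..1}" and "\<bar>f i y - e\<bar> \<le> t"
            using Suc.prems(2) by (auto simp: P_def)
          moreover have "\<rho> i * \<bar>y - e\<bar> \<le> \<bar>f i y - f i e\<bar>"
            using abs_lower[of i e y] i y01 assms(1) by auto
          \<comment> \<open>\<open>f i\<close> is increasing with values in \<open>{0..1}\<close>,
            so \<open>f i e\<close> lies between \<open>e\<close> and \<open>f i y\<close>.\<close>
          moreover have "\<bar>f i y - f i e\<bar> \<le> \<bar>f i y - e\<bar>"
            using assms(1) mono[of i 0 y] mono[of i y 1] maps[of i 0] maps[of i 1] y01 i by auto
          ultimately show "y \<in> {0..1} \<and> \<bar>y - e\<bar> \<le> t / \<rho> i"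
            using \<rho>_pos[OF i(1)] by (auto simp: field_simps)
        qed
      qed (use Suc.prems in auto)
      finally show ?thesis .
    qed
  qed
qed

text \<open>
  If \<open>J\<close> meets only one of the images \<open>f i ` {0..1}\<close>, pull it back; otherwise every nonempty
  pullback lies near an endpoint of \<open>{0..1}\<close>.
\<close>

lemma mass_le:
  assumes "0 < t" "\<And>x y. x \<in> J \<Longrightarrow> y \<in> J \<Longrightarrow> \<bar>x - y\<bar> \<le> t"
  shows "mass s p k J \<le> card I * (1 / Min (\<rho> ` I)) powr s * max t (Max (\<rho> ` I) ^ k) powr s"
  using assms
proof (induction k arbitrary: J t)
  case 0
  have "0 < Min (\<rho> ` I)" "Min (\<rho> ` I) < 1"
    using \<rho>_pos \<rho>_less_1 finite_I nonempty_I by (auto simp: Min_gr_iff Min_less_iff)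
  moreover have "1 \<le> real (card I)"
    using finite_I nonempty_I by (simp add: Suc_leI card_gt_0_iff)
  moreover have "1 * 1 * 1 \<le> real (card I) * (1 / Min (\<rho> ` I)) powr s * max t 1 powr s"
    using calculation s_nonneg by (intro mult_mono ge_one_powr_ge_zero) auto
  ultimately show ?case
    using mass_le_1[of 0 J] by simp
next
  case (Suc k)
  let ?b = "Min (\<rho> ` I)" and ?c = "Max (\<rho> ` I)"
  define A where "A = (1 / ?b) powr s"
  have A: "0 \<le> A"
    by (simp add: A_def)
  define P where "P i = {y\<in>{0..1}. f i y \<in> J}" for i
  show ?case
  proof (cases "\<exists>i\<in>I. \<forall>j\<in>I. j \<noteq> i \<longrightarrow> P j = {}")
    case True
    then obtain i where i: "i \<in> I" and empty: "\<And>j. j \<in> I \<Longrightarrow> j \<noteq> i \<Longrightarrow> P j = {}"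
      by blast
    have "mass s p (Suc k) J = (\<Sum>j\<in>I. if j = i then \<rho> i powr s * mass s p k (P i) else 0)"
      unfolding mass_Suc[OF p] P_def[symmetric] by (intro sum.cong) (auto simp: empty mass_empty)
    also have "\<dots> = \<rho> i powr s * mass s p k (P i)"
      using i finite_I by simp
    also have "\<dots> \<le> card I * A * max t (?c ^ Suc k) powr s"
    proof (rule mass_scaled[OF i])
      show "mass s p k (P i) \<le> card I * A * max (t / \<rho> i) (?c ^ k) powr s"
        unfolding A_def
      proof (rule Suc.IH)
        show "0 < t / \<rho> i"
          using Suc.prems \<rho>_pos i by simp
        fix x y assume xy: "x \<in> P i" "y \<in> P i"
        then have "\<rho> i * \<bar>x - y\<bar> \<le> \<bar>f i x - f i y\<bar>" "\<bar>f i x - f i y\<bar> \<le> t"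
          using abs_lower[of i y x] i Suc.prems(2) by (auto simp: P_def)
        then show "\<bar>x - y\<bar> \<le> t / \<rho> i"
          using \<rho>_pos[OF i] by (auto simp: field_simps)
      qed
    qed (use Suc.prems A in auto)
    finally show ?thesis
      by (simp add: A_def)
  next
    case False
    \<comment> \<open>Here the endpoint estimate replaces the induction hypothesis. Its constant has
      no factor \<open>card I\<close>, so summing over \<open>I\<close> produces this factor only
      once, not once per level.\<close>
    have "\<rho> i powr s * mass s p k (P i) \<le> A * max t (?c ^ Suc k) powr s" if i: "i \<in> I" for i
    proof -
      obtain j z where j: "j \<in> I" "j \<noteq> i" "z \<in> P j"
        using False i by blast
      \<comment> \<open>\<open>f i e\<close> is the end of the image of \<open>f i\<close> that
        faces the image of \<open>f j\<close>. Since \<open>f j z\<close> lies beyond it, points of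
        \<open>J\<close> in the image of \<open>f i\<close> are within \<open>t\<close> of
        it.\<close>
      define e :: real where "e = (if f i 1 \<le> f j 0 then 1 else 0)"
      have "mass s p k (P i) \<le> (1 / ?b) powr s * max (t / \<rho> i) (?c ^ k) powr s"
      proof (rule mass_near_endpoint)
        show "e \<in> {0, 1}"
          by (simp add: e_def)
        show "0 < t / \<rho> i"
          using Suc.prems \<rho>_pos i by simp
        fix y assume y: "y \<in> P i"
        then have y01: "y \<in> {0..1}" and "z \<in> {0..1}" and t: "\<bar>f i y - f j z\<bar> \<le> t"
          using Suc.prems(2) j by (auto simp: P_def)
        then have "f i 0 \<le> f i y" "f i y \<le> f i 1" "f j 0 \<le> f j z" "f j z \<le> f j 1"
          using mono i j by auto
        then have "\<bar>f i y - f i e\<bar> \<le> t"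
          using t separated[of i j] i j by (auto simp: e_def)
        moreover have "\<rho> i * \<bar>y - e\<bar> \<le> \<bar>f i y - f i e\<bar>"
          using abs_lower[of i e y] i y01 by (auto simp: e_def)
        ultimately show "y \<in> {0..1} \<and> \<bar>y - e\<bar> \<le> t / \<rho> i"
          using \<rho>_pos[OF i] y01 by (auto simp: field_simps)
      qed
      then show ?thesis
        using Suc.prems A i by (intro mass_scaled) (auto simp: A_def)
    qed
    then have "mass s p (Suc k) J \<le> (\<Sum>i\<in>I. A * max t (?c ^ Suc k) powr s)"
      unfolding mass_Suc[OF p] P_def[symmetric] by (rule sum_mono)
    then show ?thesis
      by (simp add: A_def mult.assoc)
  qed
qed

end

text \<open>Measure zero at some \<open>s < L\<close> would give a finite open cover of
  \<open>X\<close> whose members carry total mass at most 1/2, although the point masses all lie in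
  \<open>X\<close> and sum to 1.\<close>

theorem hausdorff_dim_ge:
  assumes L: "(\<Sum>i\<in>I. \<rho> i powr L) = 1"
  shows "ereal L \<le> hausdorff_dim X"
  unfolding hausdorff_dim_def
proof (rule Inf_greatest)
  fix s' assume "s' \<in> {ereal s |s. 0 \<le> s \<and> hausdorff_measure s X = 0}"
  then obtain s where s': "s' = ereal s" and s: "0 \<le> s" "hausdorff_measure s X = 0"
    by blast
  have "\<not> s < L"
  proof
    assume "s < L"
    \<comment> \<open>The constant of \<open>mass_le\<close>, with \<open>2 powr L\<close> added
      because a ball of radius \<open>r\<close> has points up to \<open>2 * r\<close> apart. The
      choice of \<open>\<epsilon>\<close> below makes \<open>C * (2 * \<epsilon>)\<close> equal to
      1/2.\<close>
    define C where "C = card I * (1 / Min (\<rho> ` I)) powr L * 2 powr L"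
    have "0 < Min (\<rho> ` I)" "0 < card I"
      using \<rho>_pos finite_I nonempty_I by (auto simp: Min_gr_iff card_gt_0_iff)
    then have C: "0 < C"
      by (simp add: C_def)
    define \<epsilon> where "\<epsilon> = 1 / (4 * C)"
    have \<epsilon>: "0 < \<epsilon>"
      using C by (simp add: \<epsilon>_def)
    \<comment> \<open>Covers of diameter at most 1 are enough: for \<open>t \<le> 1\<close> and
      \<open>s < L\<close>, \<open>t powr L\<close> is at most the contribution of a nonempty set of
      diameter \<open>t\<close>, also when \<open>s = 0\<close>.\<close>
    have "hausdorff_premeasure s 1 X \<le> hausdorff_measure s X"
      unfolding hausdorff_measure_def by (rule SUP_upper) simp
    then have "hausdorff_premeasure s 1 X < ennreal \<epsilon>"
      using s \<epsilon> by simp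
    then obtain U where U: "U \<in> delta_covers 1 X" and sum: "(\<Sum>i. ennreal (diam_powr s (U i))) < ennreal \<epsilon>"
      unfolding hausdorff_premeasure_def INF_less_iff by blast
    \<comment> \<open>Each \<open>U i\<close> is thickened to an open ball of radius slightly above
      its diameter. The errors add up to at most \<open>\<epsilon>\<close>.\<close>
    have "\<exists>B r. open B \<and> U i \<subseteq> B \<and> 0 < r \<and> (\<forall>x\<in>B. \<forall>y\<in>B. \<bar>x - y\<bar> \<le> 2 * r) \<and>
        r powr L \<le> diam_powr s (U i) + \<epsilon> * (1 / 2) ^ Suc i" for i
    proof -
      define t where "t = diameter (U i)"
      have t: "bounded (U i)" "0 \<le> t" "t \<le> 1"
        using U by (auto simp: delta_covers_def t_def diameter_ge_0)
      \<comment> \<open>The diameter \<open>t\<close> may be 0; the limit then relies on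
        \<open>0 < L\<close>.\<close>
      have "((\<lambda>r. r powr L) \<longlongrightarrow> t powr L) (at_right t)"
        using t \<open>s < L\<close> s by (intro tendsto_powr' tendsto_intros) (auto simp: eventually_at_filter)
      then have "eventually (\<lambda>r. r powr L < t powr L + \<epsilon> * (1 / 2) ^ Suc i) (at_right t)"
        by (rule order_tendstoD(2)) (use \<epsilon> in auto)
      then obtain r where r: "t < r" "r powr L < t powr L + \<epsilon> * (1 / 2) ^ Suc i"
        unfolding eventually_at_right_field using dense by (metis)
      show ?thesis
      proof (cases "U i = {}")
        case True
        then show ?thesis
          using r t by (intro exI[of _ "{}"] exI[of _ r]) (auto simp: t_def diam_powr_def)
      next
        case False
        then obtain a where a: "a \<in> U i" by blast
        have "t powr L \<le> diam_powr s (U i)"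
        proof (cases "s = 0")
          case True
          then show ?thesis
            using t False \<open>s < L\<close> by (auto simp: diam_powr_def powr_le1)
        next
          case False
          then show ?thesis
            using t \<open>s < L\<close> by (auto simp: diam_powr_def t_def[symmetric] intro: powr_mono')
        qed
        moreover have "U i \<subseteq> ball a r"
          using diameter_bounded_bound[OF t(1) a] r by (force simp: t_def)
        moreover have "\<bar>x - y\<bar> \<le> 2 * r" if "x \<in> ball a r" "y \<in> ball a r" for x y
          using that by (auto simp: dist_real_def)
        ultimately show ?thesis
          using r t by (intro exI[of _ "ball a r"] exI[of _ r]) auto
      qed
    qed
    then obtain B r where "\<And>i. open (B i)" and UB: "\<And>i. U i \<subseteq> B i" and r: "\<And>i. 0 < r i"
      and B: "\<And>i x y. x \<in> B i \<Longrightarrow> y \<in> B i \<Longrightarrow> \<bar>x - y\<bar> \<le> 2 * r i"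
      and r_le: "\<And>i. r i powr L \<le> diam_powr s (U i) + \<epsilon> * (1 / 2) ^ Suc i"
      by metis
    have "X \<subseteq> (\<Union>i. B i)"
      using U UB by (fastforce simp: delta_covers_def)
    then obtain F where F: "finite F" "X \<subseteq> (\<Union>i\<in>F. B i)"
      using compactE_image[OF compact_X, of UNIV B] \<open>\<And>i. open (B i)\<close> by auto
    have "F \<noteq> {}"
      using F nonempty_X by auto
    obtain p where p: "p \<in> X"
      using nonempty_X by blast
    then have p01: "p \<in> {0..1}"
      using X_subset by blast
    have "0 \<le> L"
      using s \<open>s < L\<close> by simp
    have "Max (\<rho> ` I) < 1" "0 < Max (\<rho> ` I)"
      using Max_bounds[of \<rho>] \<rho>_pos \<rho>_less_1 by auto
    \<comment> \<open>Only after passing to a finite subcover is there a smallest radius; at this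
      level the resolution is finer than all radii, so the maximum in \<open>mass_le\<close> is
      \<open>2 * r i\<close>.\<close>
    then obtain k where k: "Max (\<rho> ` I) ^ k < Min (r ` F)"
      using real_arch_pow_inv[of "Min (r ` F)" "Max (\<rho> ` I)"] r F \<open>F \<noteq> {}\<close>
      by (metis Min_in finite_imageI imageE image_is_empty)
    have small: "mass L p k (B i) \<le> C * r i powr L" if "i \<in> F" for i
    proof -
      have "Min (r ` F) \<le> r i"
        using F that by simp
      then have "max (2 * r i) (Max (\<rho> ` I) ^ k) = 2 * r i"
        using k r[of i] by (intro max_absorb1) linarith
      moreover have "mass L p k (B i) \<le> card I * (1 / Min (\<rho> ` I)) powr L * max (2 * r i) (Max (\<rho> ` I) ^ k) powr L"
        using mass_le[OF L \<open>0 \<le> L\<close> p01, of "2 * r i" "B i"] r B by simp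
      ultimately show ?thesis
        using r[of i] by (simp add: C_def powr_mult mult.assoc)
    qed
    have "1 = (\<Sum>w\<in>words I k. prod_list (map \<rho> w) powr L)"
      using sum_words_powr[of \<rho> L k] \<rho>_pos L by simp
    also have "\<dots> \<le> (\<Sum>w\<in>words I k. \<Sum>i\<in>F. if foldr f w p \<in> B i then prod_list (map \<rho> w) powr L else 0)"
    proof (rule sum_mono)
      fix w assume "w \<in> words I k"
      then have "foldr f w p \<in> X"
        using p by (auto simp: words_def foldr_in_X)
      then obtain i where i: "i \<in> F" "foldr f w p \<in> B i"
        using F by blast
      then show "prod_list (map \<rho> w) powr L \<le> (\<Sum>i\<in>F. if foldr f w p \<in> B i then prod_list (map \<rho> w) powr L else 0)"
        using F member_le_sum[of i F "\<lambda>i. if foldr f w p \<in> B i then prod_list (map \<rho> w) powr L else 0"] by auto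
    qed
    also have "\<dots> = (\<Sum>i\<in>F. mass L p k (B i))"
      unfolding mass_def by (rule sum.swap)
    also have "\<dots> \<le> (\<Sum>i\<in>F. C * (diam_powr s (U i) + \<epsilon> * (1 / 2) ^ Suc i))"
      using C r_le by (intro sum_mono order_trans[OF small] mult_left_mono) auto
    also have "\<dots> = C * ((\<Sum>i\<in>F. diam_powr s (U i)) + \<epsilon> * (\<Sum>i\<in>F. (1 / 2) ^ Suc i))"
      by (simp add: sum.distrib sum_distrib_left algebra_simps)
    also have "\<dots> \<le> C * (\<epsilon> + \<epsilon> * 1)"
    proof (intro mult_left_mono add_mono)
      have nonneg: "0 \<le> diam_powr s (U i)" for i
        by (simp add: diam_powr_def)
      then have "ennreal (\<Sum>i\<in>F. diam_powr s (U i)) = (\<Sum>i\<in>F. ennreal (diam_powr s (U i)))"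
        by (simp add: sum_ennreal)
      also have "\<dots> \<le> (\<Sum>i. ennreal (diam_powr s (U i)))"
        using F by (intro sum_le_suminf) auto
      also have "\<dots> \<le> ennreal \<epsilon>"
        using sum by simp
      finally show "(\<Sum>i\<in>F. diam_powr s (U i)) \<le> \<epsilon>"
        using \<epsilon> by (simp add: ennreal_le_iff)
      show "(\<Sum>i\<in>F. (1 / 2) ^ Suc i) \<le> (1 :: real)"
        using sum_le_suminf[OF sums_summable[OF power_half_series] F(1)]
          sums_unique[OF power_half_series] by simp
    qed (use C \<epsilon> in auto)
    also have "\<dots> = 1 / 2"
      using C by (simp add: \<epsilon>_def field_simps)
    finally show False by simp
  qed
  then show "ereal L \<le> s'"
    by (simp add: s')
qed

end

section \<open>Words of logarithmic maps\<close>

lemma clog_word_simps [simp]: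
  "clog_word m [] x = x" "clog_word m (d # ds) x = clog_map m d (clog_word m ds x)"
  by (simp_all add: clog_word_def)

lemma clog_word_append: "clog_word m (ds @ es) x = clog_word m ds (clog_word m es x)"
  by (simp add: clog_word_def)

text \<open>The derivative of \<open>clog_word m ds\<close> as the chain rule gives it, in a form
  suited to induction on the word.\<close>

primrec clog_slope :: "nat \<Rightarrow> nat list \<Rightarrow> real \<Rightarrow> real" where
  "clog_slope m [] x = 1"
| "clog_slope m (d # ds) x = clog_slope m ds x / (ln (real m) * (real d + clog_word m ds x))"

lemma digit_words_Suc: "digit_words D (Suc n) = (\<Union>d\<in>D. (#) d ` digit_words D n)"
  by (auto simp: digit_words_def length_Suc_conv)

lemma digit_words_0: "digit_words D 0 = {[]}"
  by (auto simp: digit_words_def)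

text \<open>With \<open>ln m\<close> above 1, a digit \<open>d \<ge> 1\<close> has slope
  \<open>1 / (ln m * (d + x)) \<le> 1 / ln m < 1\<close> on the whole interval.\<close>

locale clog_base =
  fixes m :: nat
  assumes ln_m: "1 < ln (real m)"
begin

lemma m_gt_1: "1 < real m"
proof (rule ccontr)
  assume "\<not> 1 < real m"
  then have "m = 0 \<or> m = 1" by auto
  then show False using ln_m by auto
qed

lemma clog_map_eq: "clog_map m d x = ln (real d + x) / ln m"
  by (simp add: clog_map_def log_def)

lemma clog_map_mono: "0 < d \<Longrightarrow> 0 \<le> x \<Longrightarrow> x \<le> y \<Longrightarrow> clog_map m d x \<le> clog_map m d y"
  using ln_m by (auto simp: clog_map_eq intro!: divide_right_mono)

lemma clog_map_range:
  assumes "d \<in> {1..m - 1}" "x \<in> {0..1}"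
  shows "clog_map m d x \<in> {0..1}"
proof -
  have "real d + x \<le> real m"
    using assms m_gt_1 by auto
  moreover have "1 \<le> real d + x"
    using assms by auto
  ultimately show ?thesis
    using m_gt_1 ln_m by (auto simp: clog_map_eq)
qed

lemma clog_word_range: "set ds \<subseteq> {1..m - 1} \<Longrightarrow> x \<in> {0..1} \<Longrightarrow> clog_word m ds x \<in> {0..1}"
  by (induction ds) (auto simp del: atLeastAtMost_iff intro!: clog_map_range)

lemma clog_word_mono:
  "set ds \<subseteq> {1..m - 1} \<Longrightarrow> 0 \<le> x \<Longrightarrow> x \<le> y \<Longrightarrow> y \<le> 1 \<Longrightarrow> clog_word m ds x \<le> clog_word m ds y"
proof (induction ds)
  case (Cons d ds)
  then show ?case
    using clog_word_range[of ds x] by (auto intro!: clog_map_mono)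
qed simp

lemma clog_word_has_derivative:
  "set ds \<subseteq> {1..m - 1} \<Longrightarrow> x \<in> {0..1} \<Longrightarrow>
    (clog_word m ds has_real_derivative clog_slope m ds x) (at x within {0..1})"
proof (induction ds)
  case Nil
  have "clog_word m [] = (\<lambda>x. x)" by auto
  then show ?case by simp
next
  case (Cons d ds)
  have "clog_word m (d # ds) = (\<lambda>x. ln (real d + clog_word m ds x) / ln m)"
    by (auto simp: clog_map_eq)
  moreover have "0 < real d + clog_word m ds x"
    using clog_word_range[of ds x] Cons.prems by auto
  ultimately show ?case
    using Cons ln_m by (auto intro!: derivative_eq_intros)
qed

text \<open>Derivatives within a nondegenerate closed interval are unique, also at its
  endpoints.\<close>

lemma clog_word_deriv_eq:
  assumes "set ds \<subseteq> {1..m - 1}" "x \<in> {0..1}"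
  shows "clog_word_deriv m ds x = clog_slope m ds x"
  unfolding clog_word_deriv_def using assms clog_word_has_derivative[OF assms]
  by (intro vector_derivative_within_closed_interval)
    (auto simp: has_real_derivative_iff_has_vector_derivative)

lemma clog_slope_pos: "set ds \<subseteq> {1..m - 1} \<Longrightarrow> x \<in> {0..1} \<Longrightarrow> 0 < clog_slope m ds x"
proof (induction ds)
  case (Cons d ds)
  then show ?case
    using clog_word_range[of ds x] ln_m by (auto intro!: divide_pos_pos mult_pos_pos)
qed simp

text \<open>The inner words increase with \<open>x\<close>, so every denominator in the chain rule
  product does too.\<close>

lemma clog_slope_antimono:
  "set ds \<subseteq> {1..m - 1} \<Longrightarrow> 0 \<le> x \<Longrightarrow> x \<le> y \<Longrightarrow> y \<le> 1 \<Longrightarrow> clog_slope m ds y \<le> clog_slope m ds x"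
proof (induction ds)
  case (Cons d ds)
  then show ?case
    using clog_word_range[of ds x] clog_word_mono[of ds x y] clog_slope_pos[of ds x] ln_m
    by (auto intro!: frac_le mult_left_mono mult_pos_pos)
qed simp

lemma clog_slope_le: "set ds \<subseteq> {1..m - 1} \<Longrightarrow> x \<in> {0..1} \<Longrightarrow> clog_slope m ds x \<le> (1 / ln m) ^ length ds"
proof (induction ds)
  case (Cons d ds)
  then have "ln m * 1 \<le> ln m * (real d + clog_word m ds x)"
    using clog_word_range[of ds x] ln_m by (intro mult_left_mono) auto
  moreover have "0 < ln (real m) * 1"
    using ln_m by simp
  moreover have "clog_slope m ds x \<le> (1 / ln m) ^ length ds" "0 < clog_slope m ds x"
    using Cons clog_slope_pos[of ds x] by auto
  ultimately have "clog_slope m (d # ds) x \<le> (1 / ln m) ^ length ds / (ln m * 1)"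
    using ln_m unfolding clog_slope.simps by (intro frac_le) auto
  then show ?case by simp
qed simp

text \<open>By the mean value theorem the difference quotient is a slope at an intermediate point,
  and slopes decrease. Hence the derivatives at 1 and at 0 serve as \<open>\<rho>\<close> and
  \<open>\<sigma>\<close>.\<close>

lemma clog_word_diff_bounds:
  assumes ds: "set ds \<subseteq> {1..m - 1}" and xy: "0 \<le> x" "x \<le> y" "y \<le> 1"
  shows "clog_slope m ds 1 * (y - x) \<le> clog_word m ds y - clog_word m ds x"
    and "clog_word m ds y - clog_word m ds x \<le> clog_slope m ds 0 * (y - x)"
proof -
  have "\<exists>z\<in>{x..y}. clog_word m ds y - clog_word m ds x = (\<lambda>h. clog_slope m ds z * h) (y - x)"
  proof (rule mvt_very_simple[OF xy(2)])
    fix z assume "x \<le> z" "z \<le> y"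
    then have "(clog_word m ds has_real_derivative clog_slope m ds z) (at z within {x..y})"
      using xy by (intro DERIV_subset[OF clog_word_has_derivative[OF ds]]) auto
    then show "(clog_word m ds has_derivative (*) (clog_slope m ds z)) (at z within {x..y})"
      by (simp add: has_field_derivative_def)
  qed
  then obtain z where z: "z \<in> {x..y}" "clog_word m ds y - clog_word m ds x = clog_slope m ds z * (y - x)"
    by blast
  have "clog_slope m ds 1 \<le> clog_slope m ds z" "clog_slope m ds z \<le> clog_slope m ds 0"
    using clog_slope_antimono[OF ds, of z 1] clog_slope_antimono[OF ds, of 0 z] z xy by auto
  then show "clog_slope m ds 1 * (y - x) \<le> clog_word m ds y - clog_word m ds x"
    and "clog_word m ds y - clog_word m ds x \<le> clog_slope m ds 0 * (y - x)"
    using z xy by (auto intro!: mult_right_mono)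
qed

text \<open>Only the first differing digit counts: \<open>a < b\<close> gives
  \<open>a + 1 \<le> b\<close>, which orders the images there, and the increasing maps of the common
  prefix keep this order.\<close>

lemma clog_word_separated:
  assumes "length ds = length es" "set ds \<subseteq> {1..m - 1}" "set es \<subseteq> {1..m - 1}" "ds \<noteq> es"
  shows "clog_word m ds 1 \<le> clog_word m es 0 \<or> clog_word m es 1 \<le> clog_word m ds 0"
  using assms
proof (induction ds es rule: list_induct2)
  case (Cons d ds e es)
  have range: "clog_word m ds 0 \<in> {0..1}" "clog_word m ds 1 \<in> {0..1}"
    "clog_word m es 0 \<in> {0..1}" "clog_word m es 1 \<in> {0..1}"
    using clog_word_range Cons.prems by auto
  have less: "clog_map m a x \<le> clog_map m b y"
    if "a < b" "0 < a" "x \<in> {0..1}" "y \<in> {0..1}" for a b x y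
  proof -
    have "real a + 1 \<le> real b"
      using that by simp
    then have "real a + x \<le> real b + y" "0 < real a + x"
      using that by auto
    then show ?thesis
      using ln_m unfolding clog_map_eq by (intro divide_right_mono) auto
  qed
  show ?case
  proof (cases d e rule: linorder_cases)
    case equal
    then have "clog_word m ds 1 \<le> clog_word m es 0 \<or> clog_word m es 1 \<le> clog_word m ds 0"
      using Cons by auto
    then show ?thesis
      using equal Cons.prems range by (auto intro!: clog_map_mono)
  next
    case d_less: less
    then show ?thesis
      using less[of d e] Cons.prems range by simp
  next
    case greater
    then show ?thesis
      using less[of e d] Cons.prems range by simp
  qed
qed simp

section \<open>Infinite continued logarithms\<close>

text \<open>A longer truncation is the shorter word evaluated at some \<open>z\<close> in
  \<open>{0..1}\<close> instead of 0. So truncations increase, by at most the slope at 0. The error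
  bound does not depend on \<open>d\<close>, which later gives uniform convergence.\<close>

lemma clog_converges:
  assumes d: "\<And>k. d k \<in> {1..m - 1}"
  shows "(\<lambda>n. clog_word m (map d [0..<n]) 0) \<longlonglongrightarrow> clog m d"
    and "\<bar>clog_word m (map d [0..<k]) 0 - clog m d\<bar> \<le> (1 / ln m) ^ k"
proof -
  define x where "x n = clog_word m (map d [0..<n]) 0" for n
  have set_d: "set (map d [i..<j]) \<subseteq> {1..m - 1}" for i j
    using d by auto
  have diff: "x k \<le> x n \<and> x n \<le> x k + (1 / ln m) ^ k" if "k \<le> n" for k n
  proof -
    define z where "z = clog_word m (map d [k..<n]) 0"
    have z: "z \<in> {0..1}"
      unfolding z_def by (rule clog_word_range[OF set_d]) simp
    have "[0..<n] = [0..<k] @ [k..<n]"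
      using that by (metis le_add_diff_inverse upt_add_eq_append zero_le)
    then have "x n = clog_word m (map d [0..<k]) z"
      by (simp add: x_def z_def clog_word_append)
    moreover have "clog_word m (map d [0..<k]) 0 \<le> clog_word m (map d [0..<k]) z"
      using z by (intro clog_word_mono[OF set_d]) auto
    moreover have "clog_word m (map d [0..<k]) z - clog_word m (map d [0..<k]) 0
        \<le> clog_slope m (map d [0..<k]) 0 * (z - 0)"
      using z by (intro clog_word_diff_bounds(2)[OF set_d]) auto
    moreover have "clog_slope m (map d [0..<k]) 0 * (z - 0) \<le> (1 / ln m) ^ k * 1"
      using z clog_slope_le[OF set_d[of 0 k], of 0] clog_slope_pos[OF set_d[of 0 k], of 0] ln_m
      by (intro mult_mono) auto
    ultimately show ?thesis
      by (simp add: x_def)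
  qed
  have "incseq x"
    using diff by (auto simp: incseq_def)
  moreover have "\<forall>n. x n \<le> 1"
    using clog_word_range[OF set_d, of 0] by (auto simp: x_def)
  ultimately have conv: "x \<longlonglongrightarrow> lim x"
    using incseq_convergent convergent_LIMSEQ_iff convergent_def by metis
  moreover have "clog m d = lim x"
    by (simp add: clog_def x_def[abs_def])
  ultimately show "(\<lambda>n. clog_word m (map d [0..<n]) 0) \<longlonglongrightarrow> clog m d"
    by (simp add: x_def[abs_def])
  have "x k \<le> lim x" "lim x \<le> x k + (1 / ln m) ^ k"
    using diff by (auto intro!: LIMSEQ_le_const[OF conv] LIMSEQ_le_const2[OF conv])
  then show "\<bar>clog_word m (map d [0..<k]) 0 - clog m d\<bar> \<le> (1 / ln m) ^ k"
    using \<open>clog m d = lim x\<close> by (simp add: x_def)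
qed

lemma clog_range:
  assumes d: "\<And>k. d k \<in> {1..m - 1}"
  shows "clog m d \<in> {0..1}"
proof -
  have "clog_word m (map d [0..<n]) 0 \<in> {0..1}" for n
    using d by (intro clog_word_range) auto
  then show ?thesis
    using LIMSEQ_le_const[OF clog_converges(1)[of d, OF d], of 0]
      LIMSEQ_le_const2[OF clog_converges(1)[of d, OF d], of 1] by auto
qed

lemma clog_unfold:
  assumes d: "\<And>k. d k \<in> {1..m - 1}"
  shows "clog m d = clog_map m (d 0) (clog m (\<lambda>k. d (Suc k)))"
proof (rule LIMSEQ_unique)
  show "(\<lambda>n. clog_word m (map d [0..<Suc n]) 0) \<longlonglongrightarrow> clog m d"
    using clog_converges(1)[of d, OF d] by (rule LIMSEQ_Suc)
  have "0 < real (d 0) + clog m (\<lambda>k. d (Suc k))"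
    using clog_range[of "\<lambda>k. d (Suc k)"] d d[of 0] by fastforce
  moreover have "(\<lambda>n. clog_word m (map (\<lambda>k. d (Suc k)) [0..<n]) 0) \<longlonglongrightarrow> clog m (\<lambda>k. d (Suc k))"
    using d by (intro clog_converges(1))
  ultimately show "(\<lambda>n. clog_word m (map d [0..<Suc n]) 0) \<longlonglongrightarrow> clog_map m (d 0) (clog m (\<lambda>k. d (Suc k)))"
    using ln_m unfolding map_upt_Suc clog_word_simps clog_map_eq by (intro tendsto_intros) auto
qed

section \<open>The attractor for a restricted digit set\<close>

context
  fixes D :: "nat set"
  assumes D: "D \<subseteq> {1..m - 1}"
begin

lemma clog_set_invariant: "clog_set m D = (\<Union>d\<in>D. clog_map m d ` clog_set m D)"
proof (intro equalityI subsetI)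
  fix x assume "x \<in> clog_set m D"
  then obtain d where d: "x = clog m d" "\<And>k. d k \<in> D"
    by (auto simp: clog_set_def)
  then have "x = clog_map m (d 0) (clog m (\<lambda>k. d (Suc k)))"
    using D by (metis clog_unfold subsetD)
  moreover have "clog m (\<lambda>k. d (Suc k)) \<in> clog_set m D"
    using d by (auto simp: clog_set_def)
  ultimately show "x \<in> (\<Union>d\<in>D. clog_map m d ` clog_set m D)"
    using d by blast
next
  fix x assume "x \<in> (\<Union>d\<in>D. clog_map m d ` clog_set m D)"
  then obtain a d where a: "a \<in> D" "\<And>k. d k \<in> D" "x = clog_map m a (clog m d)"
    by (auto simp: clog_set_def)
  define e where "e = case_nat a d"
  have e: "e k \<in> D" for k
    using a by (cases k) (auto simp: e_def)
  then have "clog m e = x"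
    using D a by (subst clog_unfold) (auto simp: e_def subset_iff)
  then show "x \<in> clog_set m D"
    using e by (auto simp: clog_set_def)
qed

lemma clog_set_invariant_words: "clog_set m D = (\<Union>ds\<in>digit_words D n. clog_word m ds ` clog_set m D)"
proof (induction n)
  case (Suc n)
  have "(\<Union>ds\<in>digit_words D (Suc n). clog_word m ds ` clog_set m D)
      = (\<Union>d\<in>D. clog_map m d ` (\<Union>ds\<in>digit_words D n. clog_word m ds ` clog_set m D))"
    unfolding digit_words_Suc by (fastforce simp: image_iff)
  then show ?case
    using Suc clog_set_invariant by simp
qed (simp add: digit_words_0 image_def)

lemma clog_set_subset: "clog_set m D \<subseteq> {0..1}"
  using D by (auto simp: clog_set_def simp del: atLeastAtMost_iff intro!: clog_range)

text \<open>The set is the image of a compact space of digit sequences under \<open>clog m\<close>,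
  which is continuous as a uniform limit of truncations depending on finitely many digits.\<close>

lemma compact_clog_set: "compact (clog_set m D)"
proof -
  define S where "S = {d :: nat \<Rightarrow> nat. \<forall>k. d k \<in> D}"
  have S: "d k \<in> {1..m - 1}" if "d \<in> S" for d k
    using that D by (auto simp: S_def)
  have "finite D"
    using D finite_subset by blast
  \<comment> \<open>Tychonoff's theorem for a product of copies of the finite set
    \<open>D\<close>.\<close>
  then have "compact S"
    using compactin_PiE[of "\<lambda>_. euclidean" UNIV "\<lambda>_::nat. D"]
    by (simp add: S_def euclidean_product_topology PiE_UNIV_domain Pi_def finite_imp_compact)
  moreover have "continuous_on S (clog m)"
  proof (rule uniform_limit_theorem)
    have word: "continuous_on S (\<lambda>d. clog_word m (map d ks) 0)" for ks
    proof (induction ks)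
      case (Cons k ks)
      have "continuous_on S (\<lambda>d. d k)"
        by (rule continuous_on_subset[OF continuous_on_product_coordinates]) simp
      moreover have pos: "0 < real (d k) + clog_word m (map d ks) 0" if "d \<in> S" for d
      proof -
        have "clog_word m (map d ks) 0 \<in> {0..1}"
          using S[OF that] by (intro clog_word_range) auto
        then show ?thesis
          using S[OF that, of k] by auto
      qed
      ultimately have "continuous_on S (\<lambda>d. ln (real (d k) + clog_word m (map d ks) 0) / ln m)"
        using Cons ln_m by (intro continuous_intros) (auto dest: pos)
      then show ?case
        by (simp add: clog_map_eq)
    qed simp
    then show "\<forall>\<^sub>F n in sequentially. continuous_on S (\<lambda>d. clog_word m (map d [0..<n]) 0)"
      by simp
    have lim: "(\<lambda>n. (1 / ln m) ^ n) \<longlonglongrightarrow> 0"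
      using ln_m by (intro LIMSEQ_power_zero) auto
    show "uniform_limit S (\<lambda>n d. clog_word m (map d [0..<n]) 0) (clog m) sequentially"
    proof (rule uniform_limitI)
      fix e :: real assume "0 < e"
      then have "eventually (\<lambda>n. (1 / ln m) ^ n < e) sequentially"
        using lim by (rule order_tendstoD(2)[rotated])
      then show "\<forall>\<^sub>F n in sequentially. \<forall>d\<in>S. dist (clog_word m (map d [0..<n]) 0) (clog m d) < e"
      proof (rule eventually_mono, intro ballI)
        fix n d assume less: "(1 / ln m) ^ n < e" and d: "d \<in> S"
        have "\<bar>clog_word m (map d [0..<n]) 0 - clog m d\<bar> \<le> (1 / ln m) ^ n"
          by (rule clog_converges(2)) (rule S[OF d])
        then show "dist (clog_word m (map d [0..<n]) 0) (clog m d) < e"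
          using less by (simp add: dist_real_def)
      qed
    qed
  qed simp
  moreover have "clog_set m D = clog m ` S"
    by (auto simp: clog_set_def S_def)
  ultimately show ?thesis
    by (simp add: compact_continuous_image)
qed

lemma clog_interval_ifs:
  assumes "D \<noteq> {}" "n \<ge> 1"
  shows "interval_ifs (digit_words D n) (clog_word m) (\<lambda>ds. clog_slope m ds 1) (\<lambda>ds. clog_slope m ds 0) (clog_set m D)"
proof
  have digits: "set ds \<subseteq> {1..m - 1}" "length ds = n" if "ds \<in> digit_words D n" for ds
    using that D by (auto simp: digit_words_def)
  obtain a where a: "a \<in> D"
    using assms by blast
  show "finite (digit_words D n)"
    using D finite_lists_length_eq[of D n] finite_subset
    by (auto simp: digit_words_def conj_commute)
  have "replicate n a \<in> digit_words D n"
    using a by (auto simp: digit_words_def)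
  then show "digit_words D n \<noteq> {}"
    by blast
  show "clog_set m D \<noteq> {}"
    using a by (auto simp: clog_set_def)
  show "clog_set m D = (\<Union>ds\<in>digit_words D n. clog_word m ds ` clog_set m D)"
    by (rule clog_set_invariant_words)
  fix ds assume ds: "ds \<in> digit_words D n"
  \<comment> \<open>Strictness uses \<open>n \<ge> 1\<close>: the empty word is the identity, with
    slope 1.\<close>
  have "(1 / ln m) ^ n < 1 ^ n"
    using ln_m assms by (intro power_strict_mono) auto
  then show "clog_slope m ds 0 < 1"
    using clog_slope_le[of ds 0] digits[OF ds] by simp
  show "0 < clog_slope m ds 1"
    by (rule clog_slope_pos) (use digits[OF ds] in auto)
  show "clog_word m ds x \<in> {0..1}" if "x \<in> {0..1}" for x
    using clog_word_range digits[OF ds] that by blast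
  show "clog_word m ds 1 \<le> clog_word m es 0 \<or> clog_word m es 1 \<le> clog_word m ds 0"
    if "es \<in> digit_words D n" "ds \<noteq> es" for es
    using clog_word_separated digits[OF ds] digits[OF that(1)] that(2) by simp
  show "clog_slope m ds 1 * (y - x) \<le> clog_word m ds y - clog_word m ds x"
    "clog_word m ds y - clog_word m ds x \<le> clog_slope m ds 0 * (y - x)"
    if "0 \<le> x" "x \<le> y" "y \<le> 1" for x y
    using clog_word_diff_bounds digits[OF ds] that by blast+
qed (fact compact_clog_set clog_set_subset)+

end

end

text \<open>Existence and uniqueness of both exponents belong to the conclusion, since they are
  introduced as the numbers solving their equations.\<close>

theorem theorem2p3:
  fixes m n :: nat and D :: "nat set"
  assumes "m \<ge> 4"
    and "D \<subseteq> {1..m - 1}"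
    and "card D > 1"
    and "n \<ge> 1"
  shows "(\<exists>!L::real. (\<Sum>ds\<in>digit_words D n. clog_word_deriv m ds 1 powr L) = 1) \<and>
    (\<exists>!U::real. (\<Sum>ds\<in>digit_words D n. clog_word_deriv m ds 0 powr U) = 1) \<and>
    (\<forall>L U :: real.
      (\<Sum>ds\<in>digit_words D n. clog_word_deriv m ds 1 powr L) = 1 \<longrightarrow>
      (\<Sum>ds\<in>digit_words D n. clog_word_deriv m ds 0 powr U) = 1 \<longrightarrow>
      ereal L \<le> hausdorff_dim (clog_set m D) \<and> hausdorff_dim (clog_set m D) \<le> ereal U)"
proof -
  \<comment> \<open>\<open>exp 1 \<le> 3 < m\<close>, which gives \<open>ln m > 1\<close>.\<close>
  have "exp 1 < real m"
    using exp_le assms(1) by linarith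
  then interpret clog_base m
    by unfold_locales (smt (verit) exp_gt_zero ln_exp ln_less_cancel_iff)
  interpret interval_ifs "digit_words D n" "clog_word m" "\<lambda>ds. clog_slope m ds 1" "\<lambda>ds. clog_slope m ds 0" "clog_set m D"
    using assms by (intro clog_interval_ifs) auto
  have deriv: "(\<Sum>ds\<in>digit_words D n. clog_word_deriv m ds x powr s) = (\<Sum>ds\<in>digit_words D n. clog_slope m ds x powr s)"
    if "x \<in> {0..1}" for x s
    using assms that by (intro sum.cong refl arg_cong2[where f = "(powr)"] clog_word_deriv_eq)
      (auto simp: digit_words_def)
  have "\<exists>!L. (\<Sum>ds\<in>digit_words D n. clog_slope m ds 1 powr L) = 1"
    using finite_I nonempty_I \<rho>_pos \<rho>_less_1 by (intro ex1_sum_powr_eq_1)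
  moreover have "\<exists>!U. (\<Sum>ds\<in>digit_words D n. clog_slope m ds 0 powr U) = 1"
    using finite_I nonempty_I \<sigma>_pos \<sigma>_less_1 by (intro ex1_sum_powr_eq_1)
  ultimately show ?thesis
    using hausdorff_dim_ge hausdorff_dim_le by (simp add: deriv)
qed

end
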